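(* Let $S$ be a semilattice with operation $\odot$, let $t$ and $s$ be two elements of $S$, and let $\{\Omega_i : i \in w\}$ be a possibly infinite family of congruences of $S$. Then $$\Big(\bigcap_{i \in w} \Omega_i\Big) \vee \Theta_{t \odot s, s} = \bigcap_{k, r \in w} \big( (\Omega_k \cap \Omega_r) \vee \Theta_{t \odot s, s} \big),$$ where the intersection on the right ranges over all pairs $(k,r) \in w \times w$ (the case $k = r$ included).
   Context: A semilattice is a set $S$ with a binary operation $\odot$ that is associative, commutative and idempotent. A congruence of $S$ is an equivalence relation on $S$ (viewed as a subset of $S \times S$) compatible with $\odot$. $\vee$ denotes the join in the lattice of congruences of $S$, and meets in this lattice are intersections (an empty intersection being $S \times S$). For $a, b \in S$, $\Theta_{a,b}$ is the principal congruence generated by $(a,b)$, i.e. the smallest congruence of $S$ containing $(a,b)$; thus $\Theta_{t \odot s, s}$ is the smallest congruence containing $(t \odot s, s)$. *)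

theory Defs
  imports Main
begin

text \<open>
  Semilattices are given by the locale \<^locale>\<open>semilattice\<close>, an operation on a whole type, so the
  type plays the role of \<open>S\<close>, and \<open>S \<times> S\<close> is \<^term>\<open>UNIV\<close>, which is also the value of an
  intersection over an empty index set.
\<close>

definition congruence :: "('a \<Rightarrow> 'a \<Rightarrow> 'a) \<Rightarrow> ('a \<times> 'a) set \<Rightarrow> bool" where
  "congruence f R \<longleftrightarrow> equiv UNIV R \<and>
     (\<forall>a b c d. (a, b) \<in> R \<longrightarrow> (c, d) \<in> R \<longrightarrow> (f a c, f b d) \<in> R)"

definition congruence_join ::
    "('a \<Rightarrow> 'a \<Rightarrow> 'a) \<Rightarrow> ('a \<times> 'a) set \<Rightarrow> ('a \<times> 'a) set \<Rightarrow> ('a \<times> 'a) set" where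
  "congruence_join f R T = \<Inter>{U. congruence f U \<and> R \<subseteq> U \<and> T \<subseteq> U}"

definition principal_congruence :: "('a \<Rightarrow> 'a \<Rightarrow> 'a) \<Rightarrow> 'a \<Rightarrow> 'a \<Rightarrow> ('a \<times> 'a) set" where
  "principal_congruence f a b = \<Inter>{U. congruence f U \<and> (a, b) \<in> U}"

lemma congruence_Inter:
  assumes "\<And>R. R \<in> \<R> \<Longrightarrow> congruence f R"
  shows "congruence f (\<Inter>\<R>)"
proof -
  have E: "equiv UNIV R" if "R \<in> \<R>" for R
    using assms that by (simp add: congruence_def)
  have "equiv UNIV (\<Inter>\<R>)"
  proof (rule equivI)
    show "refl (\<Inter>\<R>)"
      using E by (auto simp: refl_on_def equiv_def)
    show "sym (\<Inter>\<R>)"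
      using E by (auto simp: equiv_def intro!: symI dest: symD)
    show "trans (\<Inter>\<R>)"
      by (rule transI) (use E in \<open>auto simp: equiv_def, meson transD\<close>)
  qed simp
  then show ?thesis
    using assms unfolding congruence_def by simp
qed

text \<open>The two intersections are the least upper bound and the least congruence they stand for.\<close>

lemma congruence_join_is_lub:
  shows "congruence f (congruence_join f R T)"
    and "R \<subseteq> congruence_join f R T"
    and "T \<subseteq> congruence_join f R T"
    and "\<lbrakk>congruence f U; R \<subseteq> U; T \<subseteq> U\<rbrakk> \<Longrightarrow> congruence_join f R T \<subseteq> U"
  unfolding congruence_join_def by (rule congruence_Inter) auto

lemma principal_congruence_is_least:
  shows "congruence f (principal_congruence f a b)"
    and "(a, b) \<in> principal_congruence f a b"
    and "\<lbrakk>congruence f U; (a, b) \<in> U\<rbrakk> \<Longrightarrow> principal_congruence f a b \<subseteq> U"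
  unfolding principal_congruence_def by (rule congruence_Inter) auto

end

theory Submission
  imports Defs
begin

text \<open>
  For a congruence \<open>R\<close>, the join \<open>R \<or> \<Theta>\<close> with \<open>\<Theta> = \<Theta>\<^bsub>t \<odot> s, s\<^esub>\<close> relates \<open>a\<close> and \<open>b\<close> iff either \<open>R\<close>
  does, or \<open>R\<close> contains \<open>(a, a \<odot> s)\<close>, \<open>(b, b \<odot> s)\<close> and \<open>(t \<odot> a, t \<odot> b)\<close>; in the second case \<open>a\<close> and
  \<open>b\<close> are joined by the path \<open>a R (a \<odot> s) \<Theta> (t \<odot> s \<odot> a) R (t \<odot> s \<odot> b) \<Theta> (b \<odot> s) R b\<close>. Both
  alternatives commute with intersections of \<open>R\<close>. If the first one fails at a member \<open>\<Omega>\<^sub>k\<close> of the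
  family, then the pairs \<open>(k, r)\<close> force the second one at every \<open>\<Omega>\<^sub>r\<close>.
\<close>

lemma congruenceD:
  assumes "congruence f R"
  shows congruence_refl: "(a, a) \<in> R"
    and congruence_sym: "(a, b) \<in> R \<Longrightarrow> (b, a) \<in> R"
    and congruence_trans: "(a, b) \<in> R \<Longrightarrow> (b, c) \<in> R \<Longrightarrow> (a, c) \<in> R"
    and congruence_compat: "(a, b) \<in> R \<Longrightarrow> (c, d) \<in> R \<Longrightarrow> (f a c, f b d) \<in> R"
proof -
  have "refl R" "sym R" "trans R"
    using assms by (simp_all add: congruence_def equiv_def)
  then show "(a, a) \<in> R"
    and "(a, b) \<in> R \<Longrightarrow> (b, a) \<in> R"
    and "(a, b) \<in> R \<Longrightarrow> (b, c) \<in> R \<Longrightarrow> (a, c) \<in> R"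
    by (simp_all only: UNIV_I refl_onD symD) (rule transD)
  show "(a, b) \<in> R \<Longrightarrow> (c, d) \<in> R \<Longrightarrow> (f a c, f b d) \<in> R"
    using assms by (simp add: congruence_def)
qed

lemma congruenceI:
  assumes "\<And>a. (a, a) \<in> R"
    and "\<And>a b. (a, b) \<in> R \<Longrightarrow> (b, a) \<in> R"
    and "\<And>a b c. (a, b) \<in> R \<Longrightarrow> (b, c) \<in> R \<Longrightarrow> (a, c) \<in> R"
    and "\<And>a b c d. (a, b) \<in> R \<Longrightarrow> (c, d) \<in> R \<Longrightarrow> (f a c, f b d) \<in> R"
  shows "congruence f R"
  unfolding congruence_def
proof (intro conjI equivI)
  show "refl R" by (rule refl_onI) (rule assms(1))
  show "sym R" by (rule symI) (rule assms(2))
  show "trans R" by (rule transI) (rule assms(3))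
qed (use assms(4) in simp_all)

text \<open>The path \<open>f a c\<close>, \<open>f b c\<close>, \<open>f b d\<close> changes one
  argument at a time, and commutativity makes both moves translations. For a union of two relations
  this avoids multiplying a pair from one by a pair from the other.\<close>

lemma congruence_translation:
  assumes "semilattice f"
    and refl: "\<And>a. (a, a) \<in> R"
    and sym: "\<And>a b. (a, b) \<in> R \<Longrightarrow> (b, a) \<in> R"
    and trans: "\<And>a b c. (a, b) \<in> R \<Longrightarrow> (b, c) \<in> R \<Longrightarrow> (a, c) \<in> R"
    and translate: "\<And>a b u. (a, b) \<in> R \<Longrightarrow> (f a u, f b u) \<in> R"
  shows "congruence f R"
proof -
  interpret semilattice f by fact
  show ?thesis
  proof (rule congruenceI)
    fix a b c d
    assume "(a, b) \<in> R" "(c, d) \<in> R"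
    then have "(f a c, f b c) \<in> R" "(f c b, f d b) \<in> R"
      by (auto intro: translate)
    then show "(f a c, f b d) \<in> R"
      by (metis trans commute)
  qed (fact refl sym trans)+
qed

lemma congruence_join_principal:
  fixes f :: "'a \<Rightarrow> 'a \<Rightarrow> 'a"
  assumes "semilattice f" and R: "congruence f R"
  shows "congruence_join f R (principal_congruence f (f t s) s) =
    R \<union> {(a, b). (a, f a s) \<in> R \<and> (b, f b s) \<in> R \<and> (f t a, f t b) \<in> R}"
    (is "?J = R \<union> ?P")
proof
  interpret semilattice f by fact
  note refl = congruence_refl[OF R] and sym = congruence_sym[OF R]
    and trans = congruence_trans[OF R] and compat = congruence_compat[OF R]
  \<comment> \<open>This carries the condition \<open>(a, f a s) \<in> R\<close> along
    \<open>R\<close>; it settles transitivity when one pair comes from \<open>R\<close> and the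
    other from \<open>?P\<close>.\<close>
  have extend: "(b, f b s) \<in> R \<and> (f t a, f t b) \<in> R"
    if "(a, b) \<in> R" "(a, f a s) \<in> R" for a b
    using that compat[OF that(1) refl[of s]] compat[OF refl[of t] that(1)] sym trans by blast
  have "congruence f (R \<union> ?P)"
  proof (rule congruence_translation)
    fix a b c
    assume "(a, b) \<in> R \<union> ?P" "(b, c) \<in> R \<union> ?P"
    then show "(a, c) \<in> R \<union> ?P"
      using extend[of b a] extend[of b c] trans sym by blast
  next
    fix a b u
    assume ab: "(a, b) \<in> R \<union> ?P"
    have "(f x u, f (f x u) s) \<in> R" if "(x, f x s) \<in> R" for x
      using compat[OF that refl, of u] by (simp add: ac_simps)
    moreover have "(f t (f a u), f t (f b u)) \<in> R" if "(f t a, f t b) \<in> R"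
      using compat[OF that refl, of u] by (simp add: ac_simps)
    ultimately show "(f a u, f b u) \<in> R \<union> ?P"
      using ab compat[OF _ refl] by blast
  qed (use assms(1) refl sym in blast)+
  \<comment> \<open>By idempotence, all three pairs required by \<open>?P\<close> are reflexive
    here.\<close>
  moreover have "(f t s, s) \<in> R \<union> ?P"
    using refl by (simp add: ac_simps)
  ultimately show "?J \<subseteq> R \<union> ?P"
    by (intro congruence_join_is_lub principal_congruence_is_least) auto
next
  interpret semilattice f by fact
  let ?\<Theta> = "principal_congruence f (f t s) s"
  note J = congruence_join_is_lub(1)[of f R ?\<Theta>]
  have sub: "R \<subseteq> ?J"
    by (rule congruence_join_is_lub)
  have "(f t s, s) \<in> ?J"
    by (rule subsetD[OF congruence_join_is_lub(3) principal_congruence_is_least(2)])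
  then have "(f (f t s) x, f s x) \<in> ?J" for x
    by (rule congruence_compat[OF J _ congruence_refl[OF J]])
  \<comment> \<open>Multiplying the generating pair by an arbitrary \<open>x\<close> gives the
    \<Theta>-links of the path, used below at \<open>a\<close> and \<open>b\<close>.\<close>
  then have theta: "(f (f t x) s, f x s) \<in> ?J" for x
    by (metis assoc commute)
  have "(a, b) \<in> ?J" if "(a, f a s) \<in> R" "(b, f b s) \<in> R" "(f t a, f t b) \<in> R" for a b
  proof -
    have "(f (f t a) s, f (f t b) s) \<in> ?J"
      using congruence_compat[OF R that(3) congruence_refl[OF R]] sub by blast
    then have "(f a s, f b s) \<in> ?J"
      by (rule congruence_trans[OF J congruence_trans[OF J congruence_sym[OF J theta]] theta])
    moreover have "(a, f a s) \<in> ?J" "(f b s, b) \<in> ?J"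
      using that(1,2) sub congruence_sym[OF R] by blast+
    ultimately show ?thesis
      using congruence_trans[OF J] by blast
  qed
  then show "R \<union> ?P \<subseteq> ?J"
    using sub by auto
qed

theorem theorem3p4:
  fixes f :: "'a \<Rightarrow> 'a \<Rightarrow> 'a"
    and t s :: 'a
    and w :: "'i set"
    and \<Omega> :: "'i \<Rightarrow> ('a \<times> 'a) set"
  assumes "semilattice f"
    and "\<And>i. i \<in> w \<Longrightarrow> congruence f (\<Omega> i)"
  shows "congruence_join f (\<Inter>i\<in>w. \<Omega> i) (principal_congruence f (f t s) s) =
    (\<Inter>(k, r)\<in>w \<times> w. congruence_join f (\<Omega> k \<inter> \<Omega> r) (principal_congruence f (f t s) s))"
proof -
  let ?\<Theta> = "principal_congruence f (f t s) s"
  let ?P = "\<lambda>R. {(a, b). (a, f a s) \<in> R \<and> (b, f b s) \<in> R \<and> (f t a, f t b) \<in> R}"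
  note join = congruence_join_principal[OF assms(1)]
  have pair: "congruence f (\<Omega> k \<inter> \<Omega> r)" if "k \<in> w" "r \<in> w" for k r
    using congruence_Inter[of "{\<Omega> k, \<Omega> r}" f] assms(2) that by auto
  have "congruence f (\<Inter>i\<in>w. \<Omega> i)"
    using assms(2) by (auto intro: congruence_Inter)
  then have "congruence_join f (\<Inter>i\<in>w. \<Omega> i) ?\<Theta> = (\<Inter>i\<in>w. \<Omega> i) \<union> ?P (\<Inter>i\<in>w. \<Omega> i)"
    by (rule join)
  \<comment> \<open>If \<open>(a, b)\<close> is outside \<open>\<Omega> k\<close>, it is outside
    every \<open>\<Omega> k \<inter> \<Omega> r\<close>, so \<open>?P\<close> holds there and hence
    for each \<open>\<Omega> r\<close>. For empty \<open>w\<close> both sides are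
    \<open>UNIV\<close>.\<close>
  also have "\<dots> = (\<Inter>(k, r)\<in>w \<times> w. \<Omega> k \<inter> \<Omega> r \<union> ?P (\<Omega> k \<inter> \<Omega> r))"
    by auto
  also have "\<dots> = (\<Inter>(k, r)\<in>w \<times> w. congruence_join f (\<Omega> k \<inter> \<Omega> r) ?\<Theta>)"
    by (intro INF_cong refl) (clarify, rule join[OF pair, symmetric])
  finally show ?thesis .
qed

end
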